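(* For $h_L,h_R>0$ and $\bar q,\Delta Z\in\mathbb R$, set $\Delta h=h_R-h_L$, $\mathrm{Fr}^2=\mathrm{Fr}^2(h_L,h_R,\bar q)=\dfrac{\bar q^2(h_L+h_R)}{2g\,h_L^2h_R^2}$, and let $$\mathcal H(h_L,h_R,\bar q,\Delta Z)=\frac14\Big(E-\operatorname{sgn}(1-\mathrm{Fr}^2)\operatorname{sgn}(\Delta Z)\sqrt{E^2+\sqrt{|\Delta Z|\,|\Delta h|^3}}\Big),\qquad E=\Delta h+\frac{1-\mathrm{Fr}^2}{4}\operatorname{sgn}(\Delta Z)\sqrt{\frac{|\Delta h|^3}{|\Delta Z|}}$$ (understood at $\Delta Z=0$ as its limit). Then $\mathcal H$ satisfies the following properties: ($\mathcal H$-1) if $\Delta Z$ and $1-\mathrm{Fr}^2$ do not simultaneously vanish: $\mathcal H$ is continuous, and $\lim_{\Delta Z\to0}\mathcal H(h_L,h_R,\bar q,\Delta Z)=0$ for all $h_L>0$, $h_R>0$ and $\bar q\in\mathbb R$; ($\mathcal H$-2) $\mathcal H(h_L,h_R,\bar q,\Delta Z)=\frac12(h_R-h_L)$ for all $(h_L,h_R,\bar q,\Delta Z)\in\mathbb R_+^\star\times\mathbb R_+^\star\times\mathbb R\times\mathbb R$ such that $\Delta Z=-(h_R-h_L)\big(1-\mathrm{Fr}^2(h_L,h_R,\bar q)\big)$, with $\mathrm{Fr}^2(h_L,h_R,\bar q)\neq1$ so that $h_R-h_L=\mathcal O(\Delta Z)$; ($\mathcal H$-3) with the notation of the context, $$\lim_{h_i^n\to0}\mathrm{Fr}^2(h_i^n,h^n_{i\pm\frac12},q_i^n)\,\mathcal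 H(h_i^n,h^n_{i\pm\frac12},q_i^n,Z_{i\pm\frac12}-Z_i)=0,$$ $$\lim_{h_i^n\to0}\frac{1}{h^n_{i-\frac12,+}+h^n_{i+\frac12,-}}\,\mathcal H(h^n_{i-\frac12,+},h^n_{i+\frac12,-},q_i^n,Z_{i+\frac12}-Z_{i-\frac12})^3=0\quad\text{and}\quad\lim_{h_i^n\to0}\frac{h^n_{i-\frac12,+}\,h^n_{i+\frac12,-}}{h^n_{i-\frac12,+}+h^n_{i+\frac12,-}}=0.$$
   Context: $g>0$ is the gravity constant, $\operatorname{sgn}$ is the sign function and $\mathbb R_+^\star$ is the set of positive reals. For each $i\in\mathbb Z$, $(h_i^n,q_i^n)$ are the water height and discharge in cell $i$ at time $t^n$ and $Z_i\in\mathbb R$ is the discrete topography in cell $i$. Convention in dry areas: $q/h\to0$ and $q^2/h^3$ stays bounded as $h\to0$; the limits $h_i^n\to0$ are taken under this convention. Intermediate states: $(h^n_{i+\frac12},q^n_{i+\frac12},Z_{i+\frac12})=(h_i^n,q_i^n,Z_i)$ if $Z_i>Z_{i+1}$, and $(h^n_{i+1},q^n_{i+1},Z_{i+1})$ otherwise. Reconstructed heights: $$h^n_{i+\frac12,-}=\max\Big(0,\,h_i^n+(Z_i-Z_{i+\frac12})+2\,\mathrm{Fr}^2(h_i^n,h^n_{i+\frac12},q_i^n)\,\mathcal H(h_i^n,h^n_{i+\frac12},q_i^n,Z_{i+\frac12}-Z_i)\Big),$$ $$h^n_{i-\frac12,+}=\max\Big(0,\,h_i^n+(Z_i-Z_{i-\frac12})+2\,\mathrm{Fr}^2(h_i^n,h^n_{i-\frac12},q_i^n)\,\mathcal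 H(h_i^n,h^n_{i-\frac12},q_i^n,Z_{i-\frac12}-Z_i)\Big).$$ Expressions involving a vanishing height are understood as limits as that height tends to $0$ through positive values.
   Formalization: In (H-1), H jumps where Fr²=1, ΔZ≠0, h_L≠h_R, so joint continuity is claimed only if Fr²≠1 or h_L=h_R (continuity in ΔZ on the full set); in (H-3), a neighbour height used as h_{i±1/2} is assumed positive, as the first limit can fail for a dry uphill neighbour. *)

theory Defs
  imports "HOL-Analysis.Analysis"
begin

definition Fr2 :: "real \<Rightarrow> real \<Rightarrow> real \<Rightarrow> real \<Rightarrow> real" where
  "Fr2 g hL hR q = q\<^sup>2 * (hL + hR) / (2 * g * hL\<^sup>2 * hR\<^sup>2)"

definition Ecal :: "real \<Rightarrow> real \<Rightarrow> real \<Rightarrow> real \<Rightarrow> real \<Rightarrow> real" where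
  "Ecal g hL hR q dZ =
     (hR - hL) + (1 - Fr2 g hL hR q) / 4 * sgn dZ * sqrt (\<bar>hR - hL\<bar> ^ 3 / \<bar>dZ\<bar>)"

text \<open>The closed formula, meaningful for \<open>dZ \<noteq> 0\<close> only (division by zero yields zero).\<close>

definition Hcal_formula :: "real \<Rightarrow> real \<Rightarrow> real \<Rightarrow> real \<Rightarrow> real \<Rightarrow> real" where
  "Hcal_formula g hL hR q dZ =
     (Ecal g hL hR q dZ - sgn (1 - Fr2 g hL hR q) * sgn dZ *
        sqrt ((Ecal g hL hR q dZ)\<^sup>2 + sqrt (\<bar>dZ\<bar> * \<bar>hR - hL\<bar> ^ 3))) / 4"

definition Hcal :: "real \<Rightarrow> real \<Rightarrow> real \<Rightarrow> real \<Rightarrow> real \<Rightarrow> real" where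
  "Hcal g hL hR q dZ =
     (if dZ = 0 then Lim (at 0) (Hcal_formula g hL hR q) else Hcal_formula g hL hR q dZ)"

text \<open>
  Hydraulic quantities are functions of the cell index \<open>i :: int\<close>. The intermediate value at the
  interface \<open>i + 1/2\<close> is \<open>upper Z u i\<close>, the one at \<open>i - 1/2\<close> is \<open>upper Z u (i - 1)\<close>; the component
  \<open>u\<close> of the intermediate state (height, discharge, topography) is taken from the cell with the
  higher bottom, and from the right cell if both bottoms agree.
\<close>

definition upper :: "(int \<Rightarrow> real) \<Rightarrow> (int \<Rightarrow> real) \<Rightarrow> int \<Rightarrow> real" where
  "upper Z u i = (if Z i > Z (i + 1) then u i else u (i + 1))"

text \<open>
  \<open>h_minus g h q Z i\<close> is the reconstructed height on the left of the interface \<open>i + 1/2\<close>, and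
  \<open>h_plus g h q Z i\<close> the one on the right of the interface \<open>i - 1/2\<close>.
\<close>

definition h_minus :: "real \<Rightarrow> (int \<Rightarrow> real) \<Rightarrow> (int \<Rightarrow> real) \<Rightarrow> (int \<Rightarrow> real) \<Rightarrow> int \<Rightarrow> real" where
  "h_minus g h q Z i =
     max 0 (h i + (Z i - upper Z Z i) +
            2 * Fr2 g (h i) (upper Z h i) (q i) *
              Hcal g (h i) (upper Z h i) (q i) (upper Z Z i - Z i))"

definition h_plus :: "real \<Rightarrow> (int \<Rightarrow> real) \<Rightarrow> (int \<Rightarrow> real) \<Rightarrow> (int \<Rightarrow> real) \<Rightarrow> int \<Rightarrow> real" where
  "h_plus g h q Z i =
     max 0 (h i + (Z i - upper Z Z (i - 1)) +
            2 * Fr2 g (h i) (upper Z h (i - 1)) (q i) *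
              Hcal g (h i) (upper Z h (i - 1)) (q i) (upper Z Z (i - 1) - Z i))"

text \<open>
  Reconstructed heights can be exactly zero, whereas \<open>Hcal\<close> and the quotients below only make sense
  for positive heights. \<open>wet_ext \<Phi> a b\<close> is \<open>\<Phi> a b\<close> if \<open>a\<close> and \<open>b\<close> are positive; each argument
  that vanishes is replaced by a limit through positive values (a joint limit if both vanish).
\<close>

definition wet :: "real \<Rightarrow> real filter" where
  "wet a = (if a = 0 then at_right 0 else principal {a})"

definition wet_ext :: "(real \<Rightarrow> real \<Rightarrow> real) \<Rightarrow> real \<Rightarrow> real \<Rightarrow> real" where
  "wet_ext \<Phi> a b = Lim (wet a \<times>\<^sub>F wet b) (\<lambda>(x, y). \<Phi> x y)"

lemma wet_ext_pos:
  assumes "a > 0" "b > 0"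
  shows "wet_ext \<Phi> a b = \<Phi> a b"
proof -
  have eq: "wet a \<times>\<^sub>F wet b = principal {(a, b)}"
    using assms by (simp add: wet_def principal_prod_principal)
  have "((\<lambda>(x, y). \<Phi> x y) \<longlongrightarrow> \<Phi> a b) (principal {(a, b)})"
    by (rule tendsto_eventually) (simp add: eventually_principal)
  moreover have "principal {(a, b)} \<noteq> bot"
    by (simp add: principal_eq_bot_iff)
  ultimately show ?thesis
    unfolding wet_ext_def eq by (intro tendsto_Lim)
qed

text \<open>
  \<open>Hcal\<close> jumps across \<open>Fr2 = 1\<close> at every point with \<open>dZ \<noteq> 0\<close> and \<open>hL \<noteq> hR\<close>, even as a function
  of the discharge alone, because \<open>sgn (1 - Fr2)\<close> does and its cofactor is nonzero there. Joint
  continuity can therefore not be claimed at such points.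
\<close>

lemma Hcal_jump:
  assumes pos: "g > 0" "hL > 0" "hR > 0" and fr: "Fr2 g hL hR q = 1"
    and nz: "dZ \<noteq> 0" "hL \<noteq> hR"
  shows "\<not> isCont (\<lambda>p. Hcal g hL hR p dZ) q"
proof
  let ?E = "\<lambda>p. Ecal g hL hR p dZ"
  let ?d = "sqrt (\<bar>dZ\<bar> * \<bar>hR - hL\<bar> ^ 3)"
  assume cont: "isCont (\<lambda>p. Hcal g hL hR p dZ) q"
  have Eq: "?E q = hR - hL" by (simp add: Ecal_def fr)
  have Hq: "Hcal g hL hR q dZ = (hR - hL) / 4"
    using nz by (simp add: Hcal_def Hcal_formula_def fr Eq)
  have contE: "isCont ?E q"
    unfolding Ecal_def Fr2_def using pos by (intro continuous_intros) auto
  have "q \<noteq> 0" using fr by (auto simp: Fr2_def)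
  have "((\<lambda>p. p + q) \<longlongrightarrow> q + q) (at q)" by (intro tendsto_intros)
  then have ev: "\<forall>\<^sub>F p in at q. p + q \<noteq> 0"
    by (rule tendsto_imp_eventually_ne) (use \<open>q \<noteq> 0\<close> in simp)
  have key: "(4 * Hcal g hL hR p dZ - ?E p)\<^sup>2 = (?E p)\<^sup>2 + ?d" if "p \<noteq> q" "p + q \<noteq> 0" for p
  proof -
    have "p\<^sup>2 \<noteq> q\<^sup>2" using that by (auto simp: power2_eq_iff)
    moreover have "Fr2 g hL hR p = p\<^sup>2 * ((hL + hR) / (2 * g * hL\<^sup>2 * hR\<^sup>2))"
      "Fr2 g hL hR q = q\<^sup>2 * ((hL + hR) / (2 * g * hL\<^sup>2 * hR\<^sup>2))"
      by (simp_all add: Fr2_def)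
    moreover have "(hL + hR) / (2 * g * hL\<^sup>2 * hR\<^sup>2) \<noteq> 0" using pos by simp
    ultimately have "Fr2 g hL hR p \<noteq> 1" using fr by (metis mult_right_cancel)
    then have s: "(sgn (1 - Fr2 g hL hR p) * sgn dZ)\<^sup>2 = 1"
      using nz by (auto simp: sgn_if)
    have "4 * Hcal g hL hR p dZ - ?E p =
        - (sgn (1 - Fr2 g hL hR p) * sgn dZ * sqrt ((?E p)\<^sup>2 + ?d))"
      using nz by (simp add: Hcal_def Hcal_formula_def diff_divide_distrib)
    then have "(4 * Hcal g hL hR p dZ - ?E p)\<^sup>2 =
        (sgn (1 - Fr2 g hL hR p) * sgn dZ)\<^sup>2 * (sqrt ((?E p)\<^sup>2 + ?d))\<^sup>2"
      by (simp only: power2_minus power_mult_distrib)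
    then show ?thesis unfolding s by simp
  qed
  have "((\<lambda>p. (4 * Hcal g hL hR p dZ - ?E p)\<^sup>2) \<longlongrightarrow>
      (4 * Hcal g hL hR q dZ - ?E q)\<^sup>2) (at q)"
    using cont contE unfolding isCont_def by (intro tendsto_intros)
  moreover have "\<forall>\<^sub>F p in at q. (4 * Hcal g hL hR p dZ - ?E p)\<^sup>2 = (?E p)\<^sup>2 + ?d"
    using ev eventually_neq_at_within[of q q UNIV] by eventually_elim (rule key)
  ultimately have "((\<lambda>p. (?E p)\<^sup>2 + ?d) \<longlongrightarrow> (4 * Hcal g hL hR q dZ - ?E q)\<^sup>2) (at q)"
    by (rule Lim_transform_eventually)
  moreover have "((\<lambda>p. (?E p)\<^sup>2 + ?d) \<longlongrightarrow> (?E q)\<^sup>2 + ?d) (at q)"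
    using contE unfolding isCont_def by (intro tendsto_intros)
  ultimately have "(?E q)\<^sup>2 + ?d = (4 * Hcal g hL hR q dZ - ?E q)\<^sup>2"
    using tendsto_unique trivial_limit_at by blast
  moreover have "4 * Hcal g hL hR q dZ - ?E q = 0" unfolding Hq Eq by (simp add: field_simps)
  moreover have "?d > 0" using nz by simp
  moreover have "(?E q)\<^sup>2 \<ge> 0" by simp
  ultimately show False by (metis add_nonneg_pos less_irrefl zero_power2)
qed

end

theory Submission
  imports Defs
begin

text \<open>
  Write \<open>d = hR - hL\<close>, \<open>F = Fr2\<close>, \<open>e = sgn (1 - F) * sgn dZ\<close> and
  \<open>w = sqrt (\<bar>dZ\<bar> * \<bar>d\<bar> ^ 3)\<close>. For \<open>F \<noteq> 1\<close> and \<open>dZ \<noteq> 0\<close> the formula reads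
  \<open>4 * Hcal = m - e * sqrt (m\<^sup>2 + w)\<close> with \<open>m = d + e * k\<close> and
  \<open>k = \<bar>1 - F\<bar> / 4 * sqrt (\<bar>d\<bar> ^ 3 / \<bar>dZ\<bar>) \<ge> 0\<close>: it is a root of the quadratic equation
  \<open>X\<^sup>2 - 2 * m * X = w\<close>, and \<open>e\<close> selects the root that is small when \<open>e * k\<close> dominates \<open>d\<close>. The
  divisions, by \<open>dZ\<close> and, inside \<open>F\<close>, by the heights, sit in \<open>k\<close>, and a large \<open>k\<close> makes \<open>Hcal\<close> small. Two
  estimates make this precise.

  The first one, \<open>abs_Hcal_le\<close>, bounds \<open>Hcal\<close> by \<open>\<bar>d\<bar> / 2 + sqrt w / 4\<close>. It does not involve \<open>F\<close>, and
  therefore survives a blow-up of the Froude number. It gives continuity at \<open>hL = hR\<close>. In a dry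
  limit it says that \<open>Hcal\<close> stays bounded, while \<open>Fr2\<close> between the drying cell and a wet neighbour
  tends to \<open>0\<close> because \<open>q / h \<rightarrow> 0\<close>; so \<open>Fr2 * Hcal \<rightarrow> 0\<close>. Hence both reconstructed heights \<open>x\<close>, \<open>y\<close> of that
  cell tend to \<open>0\<close>. Since \<open>\<bar>d\<bar> \<le> x + y\<close>, the same estimate shows that \<open>Hcal ^ 3\<close> is at most of the order
  \<open>(x + y) powr (9 / 4)\<close>, which beats the factor \<open>1 / (x + y)\<close>. The quotient
  \<open>x * y / (x + y)\<close> is at most \<open>x + y\<close>.

  The second one, \<open>abs_Hcal_formula_le_divide\<close>, says \<open>\<bar>Hcal\<bar> \<le> \<bar>dZ\<bar> / \<bar>1 - F\<bar>\<close> as soon as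
  \<open>64 * \<bar>dZ\<bar> \<le> (1 - F)\<^sup>2 * \<bar>d\<bar>\<close>. For \<open>dZ \<rightarrow> 0\<close> with \<open>F \<noteq> 1\<close> and \<open>d \<noteq> 0\<close> it is the limit \<open>0\<close> of the first
  property; for \<open>F \<rightarrow> \<infinity>\<close>, as happens when exactly one height vanishes at a nonzero discharge, it
  shows that the extension of \<open>Hcal\<close> to vanishing heights exists.

  The second property is a computation: at \<open>dZ = - d * (1 - F)\<close> the radicand \<open>m\<^sup>2 + w\<close> is a perfect
  square.
\<close>

section \<open>Two estimates of the height correction\<close>

text \<open>
  If \<open>d + e * k\<close> has the sign of \<open>e\<close>, it cancels against the square root up to \<open>sqrt w\<close>. Otherwise
  \<open>d\<close> dominates \<open>k\<close>, and the two terms add up to at most twice \<open>\<bar>d\<bar>\<close> besides \<open>sqrt w\<close>. In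
  both cases \<open>k\<close> disappears.
\<close>

lemma abs_shifted_root_le:
  fixes d e k w :: real
  assumes "\<bar>e\<bar> = 1" "k \<ge> 0" "w \<ge> 0"
  shows "\<bar>(d + e * k) - e * sqrt ((d + e * k)\<^sup>2 + w)\<bar> \<le> 2 * \<bar>d\<bar> + sqrt w"
proof -
  have "sqrt ((d + e * k)\<^sup>2 + w) \<le> \<bar>d + e * k\<bar> + sqrt w"
    using sqrt_add_le_add_sqrt[of "(d + e * k)\<^sup>2" w] assms by simp
  moreover have "\<bar>d + e * k\<bar> \<le> sqrt ((d + e * k)\<^sup>2 + w)"
    using assms by (intro real_le_rsqrt) simp
  moreover have "e = 1 \<or> e = -1" using assms by linarith
  moreover have "sqrt w \<ge> 0" using assms by simp
  ultimately show ?thesis using assms(2) by (elim disjE) (simp_all add: abs_if split: if_splits)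
qed

text \<open>
  With \<open>k\<close> dominating \<open>d\<close>, the difference is \<open>sqrt (m\<^sup>2 + w) - m\<close> up to sign, for
  \<open>m = k + e * d \<ge> k / 2\<close>; multiplying by the conjugate bounds it by \<open>w / (2 * m)\<close>.
\<close>

lemma abs_shifted_root_le_divide:
  fixes d e k w :: real
  assumes "\<bar>e\<bar> = 1" "k > 0" "2 * \<bar>d\<bar> \<le> k" "w \<ge> 0"
  shows "\<bar>(d + e * k) - e * sqrt ((d + e * k)\<^sup>2 + w)\<bar> \<le> w / k"
proof -
  define m where "m = e * d + k"
  have m: "2 * m \<ge> k" using assms by (auto simp: m_def abs_if split: if_splits)
  have "m > 0" using m assms by linarith
  have ee: "e * e = 1" using assms(1) by (metis abs_mult_self_eq mult_1)
  have dm: "d + e * k = e * m" by (simp add: m_def ring_distribs flip: mult.assoc, simp add: ee)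
  have "sqrt (m\<^sup>2 + w) \<le> m + w / (2 * m)"
    using \<open>m > 0\<close> assms(4) by (intro real_le_lsqrt) (auto simp: power2_sum)
  moreover have "w / (2 * m) \<le> w / k"
    using m assms by (intro divide_left_mono) auto
  moreover have "m \<le> sqrt (m\<^sup>2 + w)"
    using assms(4) by (intro real_le_rsqrt) simp
  ultimately have "\<bar>m - sqrt (m\<^sup>2 + w)\<bar> \<le> w / k" by linarith
  moreover have "(d + e * k) - e * sqrt ((d + e * k)\<^sup>2 + w) = e * (m - sqrt (m\<^sup>2 + w))"
    unfolding dm using ee by (simp add: power2_eq_square algebra_simps)
  ultimately show ?thesis by (simp add: abs_mult assms(1))
qed

text \<open>
  The sign of \<open>1 - Fr2\<close> is moved out, so that the same sign \<open>sgn (1 - Fr2) * sgn dZ\<close> occurs here and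
  in front of the square root in \<open>Hcal_formula\<close>.
\<close>

lemma Ecal_signed:
  "Ecal g hL hR q dZ = (hR - hL) + (sgn (1 - Fr2 g hL hR q) * sgn dZ) *
     (\<bar>1 - Fr2 g hL hR q\<bar> / 4 * sqrt (\<bar>hR - hL\<bar> ^ 3 / \<bar>dZ\<bar>))"
proof -
  have "1 - Fr2 g hL hR q = sgn (1 - Fr2 g hL hR q) * \<bar>1 - Fr2 g hL hR q\<bar>"
    by (simp add: sgn_mult_abs)
  then show ?thesis unfolding Ecal_def by simp
qed

lemma Hcal_formula_critical:
  assumes "Fr2 g hL hR q = 1"
  shows "Hcal_formula g hL hR q dZ = (hR - hL) / 4"
  using assms by (simp add: Hcal_formula_def Ecal_def)

lemma abs_Hcal_formula_le:
  assumes "dZ \<noteq> 0"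
  shows "\<bar>Hcal_formula g hL hR q dZ\<bar> \<le>
    \<bar>hR - hL\<bar> / 2 + sqrt (sqrt (\<bar>dZ\<bar> * \<bar>hR - hL\<bar> ^ 3)) / 4"
proof (cases "Fr2 g hL hR q = 1")
  case True
  have "sqrt (sqrt (\<bar>dZ\<bar> * \<bar>hR - hL\<bar> ^ 3)) \<ge> 0" by simp
  moreover have "\<bar>(hR - hL) / 4\<bar> = \<bar>hR - hL\<bar> / 4" by simp
  ultimately show ?thesis
    unfolding Hcal_formula_critical[OF True] using abs_ge_zero[of "hR - hL"] by linarith
next
  case False
  define e where "e = sgn (1 - Fr2 g hL hR q) * sgn dZ"
  define k where "k = \<bar>1 - Fr2 g hL hR q\<bar> / 4 * sqrt (\<bar>hR - hL\<bar> ^ 3 / \<bar>dZ\<bar>)"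
  have "\<bar>e\<bar> = 1" using False assms by (simp add: e_def abs_mult abs_sgn_eq)
  moreover have "k \<ge> 0" by (simp add: k_def)
  moreover have "sqrt (\<bar>dZ\<bar> * \<bar>hR - hL\<bar> ^ 3) \<ge> 0" by simp
  ultimately show ?thesis
    using abs_shifted_root_le[of e k "sqrt (\<bar>dZ\<bar> * \<bar>hR - hL\<bar> ^ 3)" "hR - hL"]
    unfolding Hcal_formula_def Ecal_signed e_def[symmetric] k_def[symmetric] by simp
qed

text \<open>
  The hypotheses on \<open>dZ\<close> force \<open>d \<noteq> 0\<close>; the inequality is then equivalent to \<open>k \<ge> 2 * \<bar>d\<bar>\<close>, which is the source
  of the constant. Then \<open>w / k\<close> bounds
  \<open>4 * \<bar>Hcal_formula\<bar>\<close>, and in \<open>w / k = 4 * \<bar>dZ\<bar> / \<bar>1 - Fr2\<bar>\<close> the powers of \<open>d\<close> cancel.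
\<close>

lemma abs_Hcal_formula_le_divide:
  assumes "dZ \<noteq> 0" and small: "64 * \<bar>dZ\<bar> \<le> (1 - Fr2 g hL hR q)\<^sup>2 * \<bar>hR - hL\<bar>"
  shows "\<bar>Hcal_formula g hL hR q dZ\<bar> \<le> \<bar>dZ\<bar> / \<bar>1 - Fr2 g hL hR q\<bar>"
proof -
  define e where "e = sgn (1 - Fr2 g hL hR q) * sgn dZ"
  define f where "f = \<bar>1 - Fr2 g hL hR q\<bar>"
  define D where "D = \<bar>hR - hL\<bar>"
  define z where "z = \<bar>dZ\<bar>"
  define k where "k = f / 4 * sqrt (D ^ 3 / z)"
  have z: "z > 0" using assms by (simp add: z_def)
  have small': "64 * z \<le> f\<^sup>2 * D" using small by (simp add: z_def f_def D_def)
  have "f\<^sup>2 * D > 0" using small' z by linarith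
  moreover have "f \<ge> 0" "D \<ge> 0" by (simp_all add: f_def D_def)
  ultimately have f: "f > 0" and D: "D > 0" by (auto simp: zero_less_mult_iff)
  have k: "k > 0" using f D z by (simp add: k_def)
  have "(2 * D)\<^sup>2 \<le> k\<^sup>2"
  proof -
    have "64 * z * D\<^sup>2 \<le> f\<^sup>2 * D * D\<^sup>2"
      using small' by (intro mult_right_mono) auto
    moreover have "k\<^sup>2 = f\<^sup>2 * D ^ 3 / (16 * z)"
      using D z by (simp add: k_def power_mult_distrib power_divide)
    then have "16 * z * k\<^sup>2 = f\<^sup>2 * D * D\<^sup>2"
      using z by (simp add: power2_eq_square power3_eq_cube)
    ultimately have "16 * z * (2 * D)\<^sup>2 \<le> 16 * z * k\<^sup>2"
      by (simp add: power_mult_distrib)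
    then show ?thesis using z by simp
  qed
  then have kd: "2 * \<bar>hR - hL\<bar> \<le> k"
    using power2_le_imp_le[of "2 * D" k] k unfolding D_def by simp
  have e: "\<bar>e\<bar> = 1" using f assms by (simp add: f_def e_def abs_mult abs_sgn_eq)
  have "sqrt (D ^ 3) > 0" using D by simp
  then have w: "sqrt (z * D ^ 3) / k = 4 * (z / f)"
    using z f real_sqrt_mult_self[of z] by (simp add: k_def real_sqrt_mult real_sqrt_divide field_simps)
  have "\<bar>Hcal_formula g hL hR q dZ\<bar> \<le> sqrt (z * D ^ 3) / k / 4"
    using abs_shifted_root_le_divide[OF e k kd, of "sqrt (z * D ^ 3)"] z D
    unfolding Hcal_formula_def Ecal_signed e_def[symmetric] k_def[symmetric]
      f_def[symmetric] D_def[symmetric] z_def[symmetric] by simp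
  then show ?thesis unfolding w by (simp add: z_def f_def)
qed

section \<open>Continuity\<close>

lemma Fr2_tendsto:
  assumes "(X \<longlongrightarrow> hL) G" "(Y \<longlongrightarrow> hR) G" "(P \<longlongrightarrow> q) G"
    and "g > 0" "hL > 0" "hR > 0"
  shows "((\<lambda>t. Fr2 g (X t) (Y t) (P t)) \<longlongrightarrow> Fr2 g hL hR q) G"
  unfolding Fr2_def using assms by (intro tendsto_intros) auto

lemma height_bound_tendsto_0:
  fixes X Y W :: "'a \<Rightarrow> real"
  assumes "(X \<longlongrightarrow> h) G" "(Y \<longlongrightarrow> h) G" "(W \<longlongrightarrow> dZ) G"
  shows "((\<lambda>t. \<bar>Y t - X t\<bar> / 2 + sqrt (sqrt (\<bar>W t\<bar> * \<bar>Y t - X t\<bar> ^ 3)) / 4) \<longlongrightarrow> 0) G"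
proof -
  have "((\<lambda>t. \<bar>Y t - X t\<bar> / 2 + sqrt (sqrt (\<bar>W t\<bar> * \<bar>Y t - X t\<bar> ^ 3)) / 4) \<longlongrightarrow>
      \<bar>h - h\<bar> / 2 + sqrt (sqrt (\<bar>dZ\<bar> * \<bar>h - h\<bar> ^ 3)) / 4) G"
    by (intro tendsto_intros assms) auto
  then show ?thesis by simp
qed

text \<open>
  The heights move together with \<open>dZ\<close>. If their limits agree, \<open>k\<close> need not dominate \<open>d\<close>, but both
  terms of the first estimate vanish; if they differ, the second estimate applies eventually.
  Stating the lemma for arbitrary filters serves the one-variable limit at \<open>dZ = 0\<close> and joint
  continuity alike. The points with \<open>W t = 0\<close> must be avoided because there the closed formula
  evaluates to a quarter of the height difference.
\<close>

lemma Hcal_formula_tendsto_0: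
  assumes X: "(X \<longlongrightarrow> hL) G" and Y: "(Y \<longlongrightarrow> hR) G" and W: "(W \<longlongrightarrow> 0) G"
    and F: "((\<lambda>t. Fr2 g (X t) (Y t) (P t)) \<longlongrightarrow> F) G" "F \<noteq> 1"
    and nz: "\<forall>\<^sub>F t in G. W t \<noteq> 0"
  shows "((\<lambda>t. Hcal_formula g (X t) (Y t) (P t) (W t)) \<longlongrightarrow> 0) G"
proof (cases "hL = hR")
  case True
  from height_bound_tendsto_0[OF X Y[folded True] W] show ?thesis
    by (rule Lim_null_comparison[rotated])
      (use nz in eventually_elim, simp only: real_norm_def, rule abs_Hcal_formula_le)
next
  case False
  let ?f = "\<lambda>t. Fr2 g (X t) (Y t) (P t)"
  have "((\<lambda>t. (1 - ?f t)\<^sup>2 * \<bar>Y t - X t\<bar> - 64 * \<bar>W t\<bar>) \<longlongrightarrow> (1 - F)\<^sup>2 * \<bar>hR - hL\<bar> - 64 * \<bar>0\<bar>) G"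
    by (intro tendsto_intros X Y W F)
  then have ev: "\<forall>\<^sub>F t in G. 0 < (1 - ?f t)\<^sup>2 * \<bar>Y t - X t\<bar> - 64 * \<bar>W t\<bar>"
    by (rule order_tendstoD) (use False F in simp)
  have "((\<lambda>t. \<bar>W t\<bar> / \<bar>1 - ?f t\<bar>) \<longlongrightarrow> \<bar>0\<bar> / \<bar>1 - F\<bar>) G"
    using F by (intro tendsto_intros W) auto
  then have "((\<lambda>t. \<bar>W t\<bar> / \<bar>1 - ?f t\<bar>) \<longlongrightarrow> 0) G" by simp
  then show ?thesis
    by (rule Lim_null_comparison[rotated])
      (use nz ev in eventually_elim, simp only: real_norm_def, rule abs_Hcal_formula_le_divide, auto)
qed

lemma Hcal_formula_tendsto_at_0:
  "(Hcal_formula g hL hR q \<longlongrightarrow> (if Fr2 g hL hR q = 1 then (hR - hL) / 4 else 0)) (at 0)"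
proof (cases "Fr2 g hL hR q = 1")
  case True
  then have "Hcal_formula g hL hR q = (\<lambda>_. (hR - hL) / 4)"
    by (simp add: Hcal_formula_critical fun_eq_iff)
  then show ?thesis using True by simp
next
  case False
  have "(Hcal_formula g hL hR q \<longlongrightarrow> 0) (at 0)"
    by (rule Hcal_formula_tendsto_0[where X = "\<lambda>_. hL" and Y = "\<lambda>_. hR" and P = "\<lambda>_. q"
          and W = "\<lambda>z. z" and F = "Fr2 g hL hR q"])
      (use False eventually_neq_at_within[of 0 0 UNIV] in auto)
  then show ?thesis using False by simp
qed

lemma Hcal_0:
  "Hcal g hL hR q 0 = (if Fr2 g hL hR q = 1 then (hR - hL) / 4 else 0)"
  unfolding Hcal_def using tendsto_Lim[OF trivial_limit_at Hcal_formula_tendsto_at_0] by simp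

lemma Hcal_nonzero: "dZ \<noteq> 0 \<Longrightarrow> Hcal g hL hR q dZ = Hcal_formula g hL hR q dZ"
  by (simp add: Hcal_def)

lemma Hcal_equal_heights: "Hcal g h h q dZ = 0"
  by (cases "dZ = 0") (simp_all add: Hcal_0 Hcal_nonzero Hcal_formula_def Ecal_def)

lemma abs_Hcal_le:
  "\<bar>Hcal g hL hR q dZ\<bar> \<le> \<bar>hR - hL\<bar> / 2 + sqrt (sqrt (\<bar>dZ\<bar> * \<bar>hR - hL\<bar> ^ 3)) / 4"
proof (cases "dZ = 0")
  case True
  have "\<bar>(hR - hL) / 4\<bar> = \<bar>hR - hL\<bar> / 4" by simp
  then show ?thesis
    using abs_ge_zero[of "hR - hL"] unfolding True Hcal_0 by (auto simp del: abs_ge_zero)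
next
  case False
  then show ?thesis using abs_Hcal_formula_le by (simp add: Hcal_nonzero)
qed

text \<open>
  For \<open>dZ \<noteq> 0\<close> the only discontinuity of the formula comes from \<open>sgn (1 - Fr2)\<close>. Assuming that
  \<open>Fr2\<close> and this sign converge, rather than positive heights and \<open>Fr2 \<noteq> 1\<close>, covers vanishing heights
  with zero discharge, and the critical case \<open>Fr2 = 1\<close> when only \<open>dZ\<close> moves.
\<close>

lemma Hcal_tendsto_nonzero:
  assumes X: "(X \<longlongrightarrow> hL) G" and Y: "(Y \<longlongrightarrow> hR) G" and W: "(W \<longlongrightarrow> dZ) G" and dZ: "dZ \<noteq> 0"
    and F: "((\<lambda>t. Fr2 g (X t) (Y t) (P t)) \<longlongrightarrow> Fr2 g hL hR q) G"
    and S: "((\<lambda>t. sgn (1 - Fr2 g (X t) (Y t) (P t))) \<longlongrightarrow> sgn (1 - Fr2 g hL hR q)) G"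
  shows "((\<lambda>t. Hcal g (X t) (Y t) (P t) (W t)) \<longlongrightarrow> Hcal g hL hR q dZ) G"
proof -
  have E: "((\<lambda>t. Ecal g (X t) (Y t) (P t) (W t)) \<longlongrightarrow> Ecal g hL hR q dZ) G"
    unfolding Ecal_def using dZ by (intro tendsto_intros X Y W F) auto
  have "((\<lambda>t. Hcal_formula g (X t) (Y t) (P t) (W t)) \<longlongrightarrow> Hcal_formula g hL hR q dZ) G"
    unfolding Hcal_formula_def using dZ by (intro tendsto_intros E S X Y W) auto
  moreover have "\<forall>\<^sub>F t in G. W t \<noteq> 0" using W dZ by (rule tendsto_imp_eventually_ne)
  then have "\<forall>\<^sub>F t in G. Hcal_formula g (X t) (Y t) (P t) (W t) = Hcal g (X t) (Y t) (P t) (W t)"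
    by eventually_elim (simp add: Hcal_nonzero)
  ultimately show ?thesis unfolding Hcal_nonzero[OF dZ] by (rule Lim_transform_eventually)
qed

lemma Hcal_tendsto:
  assumes g: "g > 0" and pos: "hL > 0" "hR > 0"
    and X: "(X \<longlongrightarrow> hL) G" and Y: "(Y \<longlongrightarrow> hR) G" and P: "(P \<longlongrightarrow> q) G" and W: "(W \<longlongrightarrow> dZ) G"
    and reg: "Fr2 g hL hR q \<noteq> 1 \<or> hL = hR \<and> dZ \<noteq> 0"
  shows "((\<lambda>t. Hcal g (X t) (Y t) (P t) (W t)) \<longlongrightarrow> Hcal g hL hR q dZ) G"
proof -
  have F: "((\<lambda>t. Fr2 g (X t) (Y t) (P t)) \<longlongrightarrow> Fr2 g hL hR q) G"
    by (rule Fr2_tendsto) (use assms in auto)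
  consider "hL = hR" | "dZ \<noteq> 0" "Fr2 g hL hR q \<noteq> 1" | "dZ = 0" "Fr2 g hL hR q \<noteq> 1"
    using reg by blast
  then show ?thesis
  proof cases
    case 1
    from height_bound_tendsto_0[OF X Y[folded 1] W]
    have "((\<lambda>t. Hcal g (X t) (Y t) (P t) (W t)) \<longlongrightarrow> 0) G"
      by (rule Lim_null_comparison[rotated])
        (intro always_eventually allI, simp only: real_norm_def, rule abs_Hcal_le)
    then show ?thesis using 1 by (simp add: Hcal_equal_heights)
  next
    case 2
    show ?thesis
      by (rule Hcal_tendsto_nonzero[OF X Y W _ F]) (use 2 in \<open>auto intro!: tendsto_intros F\<close>)
  next
    case 3
    \<comment> \<open>Near the limit, \<open>Fr2 \<noteq> 1\<close>, so that \<open>Hcal\<close> vanishes wherever \<open>W t = 0\<close>; elsewhere it is given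
      by the formula.\<close>
    let ?H = "\<lambda>t. Hcal_formula g (X t) (Y t) (P t) (W t)"
    let ?G = "inf G (principal {t. W t \<noteq> 0})"
    have le: "?G \<le> G" by simp
    have "(?H \<longlongrightarrow> 0) ?G"
      by (rule Hcal_formula_tendsto_0[of _ hL _ _ hR _ _ _ "Fr2 g hL hR q"])
        (use tendsto_mono[OF le X] tendsto_mono[OF le Y] tendsto_mono[OF le W] tendsto_mono[OF le F] 3
          in \<open>auto simp: eventually_inf_principal\<close>)
    then have "((\<lambda>t. if W t \<noteq> 0 then ?H t else 0) \<longlongrightarrow> 0) G"
      by (intro filterlim_If) auto
    moreover have "\<forall>\<^sub>F t in G. Fr2 g (X t) (Y t) (P t) \<noteq> 1"
      using F 3(2) by (rule tendsto_imp_eventually_ne)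
    then have "\<forall>\<^sub>F t in G. (if W t \<noteq> 0 then ?H t else 0) = Hcal g (X t) (Y t) (P t) (W t)"
      by eventually_elim (auto simp: Hcal_0 Hcal_nonzero)
    ultimately have "((\<lambda>t. Hcal g (X t) (Y t) (P t) (W t)) \<longlongrightarrow> 0) G"
      by (rule Lim_transform_eventually)
    then show ?thesis using 3 by (simp add: Hcal_0)
  qed
qed

lemma isCont_Hcal_dZ:
  assumes "dZ = 0 \<longrightarrow> Fr2 g hL hR q \<noteq> 1"
  shows "isCont (\<lambda>z. Hcal g hL hR q z) dZ"
proof (cases "dZ = 0")
  case True
  with assms have F: "Fr2 g hL hR q \<noteq> 1" by simp
  have "\<forall>\<^sub>F z in at 0. Hcal_formula g hL hR q z = Hcal g hL hR q z"
    using eventually_neq_at_within[of 0 0 UNIV] by eventually_elim (simp add: Hcal_nonzero)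
  with Hcal_formula_tendsto_at_0[of g hL hR q] show ?thesis
    using True F unfolding isCont_def by (simp add: Hcal_0 Lim_transform_eventually)
next
  case False
  then show ?thesis unfolding isCont_def
    by (intro Hcal_tendsto_nonzero tendsto_intros)
qed

section \<open>The equilibrium value\<close>

text \<open>
  With \<open>r = sqrt \<bar>1 - Fr2\<bar>\<close> the hypothesis gives \<open>Ecal = d * (1 - r / 4)\<close> and \<open>w = d\<^sup>2 * r\<close>. Hence the
  radicand is \<open>(d * (1 + r / 4))\<^sup>2\<close>, and the sign in front of the root is such that \<open>r\<close> cancels.
\<close>

lemma Hcal_equilibrium:
  assumes dZ: "dZ = - (hR - hL) * (1 - Fr2 g hL hR q)" and F: "Fr2 g hL hR q \<noteq> 1"
  shows "Hcal g hL hR q dZ = (hR - hL) / 2"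
proof (cases "hL = hR")
  case True
  then show ?thesis by (simp add: Hcal_equal_heights)
next
  case False
  define d where "d = hR - hL"
  define f where "f = 1 - Fr2 g hL hR q"
  define r where "r = sqrt \<bar>f\<bar>"
  have d: "d \<noteq> 0" and f: "f \<noteq> 0" using False F by (simp_all add: d_def f_def)
  have r: "r > 0" and rr: "r * r = \<bar>f\<bar>" using f by (simp_all add: r_def)
  have z: "dZ = - d * f" using dZ by (simp add: d_def f_def)
  have sg: "sgn f * sgn dZ = - sgn d"
    using f unfolding z sgn_mult sgn_minus by (simp add: sgn_if)
  have dd: "\<bar>d\<bar> ^ 3 = d\<^sup>2 * \<bar>d\<bar>" by (simp add: power3_eq_cube power2_eq_square)
  have s1: "sqrt (\<bar>d\<bar> ^ 3 / \<bar>dZ\<bar>) = \<bar>d\<bar> / r"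
    using d f by (simp add: z dd abs_mult real_sqrt_divide r_def)
  have s2: "sqrt (\<bar>dZ\<bar> * \<bar>d\<bar> ^ 3) = d\<^sup>2 * r"
  proof -
    have "\<bar>dZ\<bar> * \<bar>d\<bar> ^ 3 = (d\<^sup>2)\<^sup>2 * \<bar>f\<bar>"
      unfolding z dd by (simp add: abs_mult power2_eq_square)
    then show ?thesis by (simp only: real_sqrt_mult real_sqrt_abs r_def) simp
  qed
  have E: "Ecal g hL hR q dZ = d * (1 - r / 4)"
  proof -
    have "Ecal g hL hR q dZ = d + - sgn d * (\<bar>f\<bar> / 4 * (\<bar>d\<bar> / r))"
      unfolding Ecal_signed f_def[symmetric] d_def[symmetric] sg s1 ..
    also have "\<dots> = d - (sgn d * \<bar>d\<bar>) * (r / 4)"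
      using r rr by (simp add: field_simps)
    finally show ?thesis unfolding sgn_mult_abs by (simp add: algebra_simps)
  qed
  have "(d * (1 - r / 4))\<^sup>2 + d\<^sup>2 * r = (d * (1 + r / 4))\<^sup>2"
    by (simp add: power2_eq_square field_simps)
  then have "sqrt ((Ecal g hL hR q dZ)\<^sup>2 + sqrt (\<bar>dZ\<bar> * \<bar>d\<bar> ^ 3)) = \<bar>d\<bar> * (1 + r / 4)"
    unfolding E s2 using r by (simp add: abs_mult)
  then have "Hcal_formula g hL hR q dZ = (d * (1 - r / 4) - - sgn d * (\<bar>d\<bar> * (1 + r / 4))) / 4"
    unfolding Hcal_formula_def f_def[symmetric] d_def[symmetric] sg E by simp
  also have "\<dots> = (d * (1 - r / 4) + (sgn d * \<bar>d\<bar>) * (1 + r / 4)) / 4" by simp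
  also have "\<dots> = d / 2" unfolding sgn_mult_abs by (simp add: field_simps)
  finally show ?thesis using d f by (simp add: Hcal_nonzero z d_def)
qed


section \<open>Extension to vanishing heights\<close>

lemma tendsto_wet: "((\<lambda>x. x) \<longlongrightarrow> a) (wet a)"
  by (auto simp: wet_def eventually_principal intro: tendsto_ident_at tendsto_eventually)

lemma wet_prod:
  assumes "a \<ge> 0" "b \<ge> 0"
  shows tendsto_fst_wet: "(fst \<longlongrightarrow> a) (wet a \<times>\<^sub>F wet b)"
    and tendsto_snd_wet: "(snd \<longlongrightarrow> b) (wet a \<times>\<^sub>F wet b)"
    and eventually_wet_pos: "\<forall>\<^sub>F p in wet a \<times>\<^sub>F wet b. fst p > 0 \<and> snd p > 0"
    and wet_prod_nontrivial: "wet a \<times>\<^sub>F wet b \<noteq> bot"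
proof -
  have pos: "\<forall>\<^sub>F x in wet c. x > 0" if "c \<ge> 0" for c
    using that by (auto simp: wet_def eventually_principal eventually_at_right_less)
  show "(fst \<longlongrightarrow> a) (wet a \<times>\<^sub>F wet b)" "(snd \<longlongrightarrow> b) (wet a \<times>\<^sub>F wet b)"
    by (rule filterlim_compose[OF tendsto_wet filterlim_fst] filterlim_compose[OF tendsto_wet filterlim_snd])+
  show "\<forall>\<^sub>F p in wet a \<times>\<^sub>F wet b. fst p > 0 \<and> snd p > 0"
    unfolding eventually_prod_filter using pos[OF assms(1)] pos[OF assms(2)] by auto
  show "wet a \<times>\<^sub>F wet b \<noteq> bot"
    by (simp add: prod_filter_eq_bot wet_def principal_eq_bot_iff)
qed

lemma convergent_wet_pos:
  assumes "a > 0" "b > 0"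
  shows "\<exists>l. ((\<lambda>(x, y). \<Phi> x y) \<longlongrightarrow> l) (wet a \<times>\<^sub>F wet b)"
proof -
  have "wet a \<times>\<^sub>F wet b = principal {(a, b)}"
    using assms by (simp add: wet_def principal_prod_principal)
  then have "\<forall>\<^sub>F p in wet a \<times>\<^sub>F wet b. (\<lambda>(x, y). \<Phi> x y) p = \<Phi> a b"
    by (simp add: eventually_principal)
  then show ?thesis by (blast intro: tendsto_eventually)
qed

text \<open>
  A bound at positive heights is inherited by the extension, because it passes to the limit. Only
  the sum of the heights enters the bound: it is what tends to \<open>0\<close> in the dry limits.
\<close>

lemma abs_wet_ext_le:
  assumes ab: "a \<ge> 0" "b \<ge> 0"
    and lim: "((\<lambda>(x, y). \<Phi> x y) \<longlongrightarrow> l) (wet a \<times>\<^sub>F wet b)"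
    and bound: "\<And>x y. x > 0 \<Longrightarrow> y > 0 \<Longrightarrow> \<bar>\<Phi> x y\<bar> \<le> B (x + y)"
    and B: "isCont B (a + b)"
  shows "\<bar>wet_ext \<Phi> a b\<bar> \<le> B (a + b)"
proof -
  have "wet_ext \<Phi> a b = l"
    unfolding wet_ext_def using wet_prod_nontrivial[OF ab] lim by (rule tendsto_Lim)
  moreover have "((\<lambda>p. B (fst p + snd p)) \<longlongrightarrow> B (a + b)) (wet a \<times>\<^sub>F wet b)"
    by (rule isCont_tendsto_compose[OF B]) (intro tendsto_intros tendsto_fst_wet tendsto_snd_wet ab)
  moreover have "((\<lambda>p. \<bar>(\<lambda>(x, y). \<Phi> x y) p\<bar>) \<longlongrightarrow> \<bar>l\<bar>) (wet a \<times>\<^sub>F wet b)"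
    by (intro tendsto_intros lim)
  moreover have "\<forall>\<^sub>F p in wet a \<times>\<^sub>F wet b. \<bar>(\<lambda>(x, y). \<Phi> x y) p\<bar> \<le> B (fst p + snd p)"
    using eventually_wet_pos[OF ab] by eventually_elim (auto simp: split_beta intro: bound)
  ultimately show ?thesis
    using tendsto_le[OF wet_prod_nontrivial[OF ab]] by blast
qed

lemma wet_ext_tendsto_0:
  assumes M: "(M \<longlongrightarrow> 0) G" "\<And>t. M t \<ge> 0" and N: "(N \<longlongrightarrow> 0) G" "\<And>t. N t \<ge> 0"
    and lim: "\<And>t a b. a \<ge> 0 \<Longrightarrow> b \<ge> 0 \<Longrightarrow> \<exists>l. ((\<lambda>(x, y). \<Phi> t x y) \<longlongrightarrow> l) (wet a \<times>\<^sub>F wet b)"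
    and bound: "\<And>t x y. x > 0 \<Longrightarrow> y > 0 \<Longrightarrow> \<bar>\<Phi> t x y\<bar> \<le> B (x + y)"
    and B: "\<And>s. isCont B s" "B 0 = 0"
  shows "((\<lambda>t. wet_ext (\<Phi> t) (M t) (N t)) \<longlongrightarrow> 0) G"
proof (rule Lim_null_comparison)
  have "((\<lambda>t. B (M t + N t)) \<longlongrightarrow> B (0 + 0)) G"
    by (rule isCont_tendsto_compose[OF B(1)]) (intro tendsto_intros M N)
  then show "((\<lambda>t. B (M t + N t)) \<longlongrightarrow> 0) G" using B by simp
  have "\<bar>wet_ext (\<Phi> t) (M t) (N t)\<bar> \<le> B (M t + N t)" for t
  proof -
    obtain l where "((\<lambda>(x, y). \<Phi> t x y) \<longlongrightarrow> l) (wet (M t) \<times>\<^sub>F wet (N t))"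
      using lim[OF M(2) N(2)] by blast
    from abs_wet_ext_le[OF M(2) N(2) this bound B(1)] show ?thesis .
  qed
  then show "\<forall>\<^sub>F t in G. norm (wet_ext (\<Phi> t) (M t) (N t)) \<le> B (M t + N t)" by simp
qed

lemma convergent_wet_half_harmonic_mean:
  fixes a b :: real
  assumes "a \<ge> 0" "b \<ge> 0"
  shows "\<exists>l. ((\<lambda>(x, y). x * y / (x + y)) \<longlongrightarrow> l) (wet a \<times>\<^sub>F wet b)"
proof (cases "a = 0 \<and> b = 0")
  case False
  have "((\<lambda>p. fst p * snd p / (fst p + snd p)) \<longlongrightarrow> a * b / (a + b)) (wet a \<times>\<^sub>F wet b)"
    using assms False by (intro tendsto_intros tendsto_fst_wet tendsto_snd_wet) auto
  then show ?thesis unfolding case_prod_beta by blast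
next
  case True
  have "((\<lambda>p. fst p * snd p / (fst p + snd p)) \<longlongrightarrow> 0) (wet a \<times>\<^sub>F wet b)"
  proof (rule Lim_null_comparison)
    show "(fst \<longlongrightarrow> 0) (wet a \<times>\<^sub>F wet b)" using tendsto_fst_wet[OF assms] True by simp
    show "\<forall>\<^sub>F p in wet a \<times>\<^sub>F wet b. norm (fst p * snd p / (fst p + snd p)) \<le> fst p"
      using eventually_wet_pos[OF assms] by eventually_elim (auto simp: field_simps)
  qed
  then show ?thesis unfolding case_prod_beta by blast
qed

text \<open>
  The two terms come from cubing the two terms of the bound in \<open>abs_Hcal_le\<close> and dividing by \<open>s\<close>.
  The nested root stands for a multiple of \<open>s powr (5 / 4)\<close>; in this form the function is continuous on
  the whole real line by the continuity rules alone.
\<close>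

definition dry_rate :: "real \<Rightarrow> real \<Rightarrow> real" where
  "dry_rate dZ s = s\<^sup>2 / 2 + sqrt (sqrt (\<bar>dZ\<bar> ^ 3 * s ^ 5)) / 16"

lemma isCont_dry_rate: "isCont (dry_rate dZ) s"
  unfolding dry_rate_def by (intro continuous_intros) auto

text \<open>
  Convexity of the cube, \<open>(u + v) ^ 3 \<le> 4 * (u ^ 3 + v ^ 3)\<close>, separates the two terms of the first
  estimate before the division by \<open>x + y\<close>.
\<close>

lemma abs_cubed_Hcal_le:
  assumes "x > 0" "y > 0"
  shows "\<bar>1 / (x + y) * (Hcal g x y q dZ) ^ 3\<bar> \<le> dry_rate dZ (x + y)"
proof -
  define s where "s = x + y"
  define v where "v = sqrt (sqrt (\<bar>dZ\<bar> * s ^ 3)) / 4"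
  have s: "s > 0" and d: "\<bar>y - x\<bar> \<le> s" using assms by (auto simp: s_def)
  have "v \<ge> 0" using s by (simp add: v_def)
  have "\<bar>dZ\<bar> * \<bar>y - x\<bar> ^ 3 \<le> \<bar>dZ\<bar> * s ^ 3"
    using d by (intro mult_left_mono power_mono) auto
  then have "sqrt (sqrt (\<bar>dZ\<bar> * \<bar>y - x\<bar> ^ 3)) / 4 \<le> v"
    by (simp add: v_def)
  moreover have "\<bar>y - x\<bar> / 2 \<le> s / 2" using d by simp
  ultimately have "\<bar>Hcal g x y q dZ\<bar> \<le> s / 2 + v"
    using abs_Hcal_le[of g x y q dZ] by (meson add_mono order_trans)
  then have "\<bar>Hcal g x y q dZ\<bar> ^ 3 \<le> (s / 2 + v) ^ 3" by (intro power_mono) auto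
  also have "\<dots> \<le> 4 * ((s / 2) ^ 3 + v ^ 3)"
  proof -
    have "4 * ((s / 2) ^ 3 + v ^ 3) - (s / 2 + v) ^ 3 = 3 * (s / 2 + v) * (s / 2 - v)\<^sup>2"
      by (simp add: power2_eq_square power3_eq_cube field_simps)
    moreover have "\<dots> \<ge> 0" using s \<open>v \<ge> 0\<close> by simp
    ultimately show ?thesis by linarith
  qed
  finally have "\<bar>Hcal g x y q dZ\<bar> ^ 3 / s \<le> (4 * ((s / 2) ^ 3 + v ^ 3)) / s"
    using s by (intro divide_right_mono) auto
  also have "\<dots> = dry_rate dZ s"
  proof -
    have "v ^ 3 = sqrt (sqrt (\<bar>dZ\<bar> ^ 3 * s ^ 9)) / 64"
      by (simp add: v_def power_divide flip: real_sqrt_power) (simp add: power_mult_distrib flip: power_mult)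
    also have "\<bar>dZ\<bar> ^ 3 * s ^ 9 = (\<bar>dZ\<bar> ^ 3 * s ^ 5) * (s\<^sup>2)\<^sup>2"
      by (simp flip: power_add power_mult)
    also have "sqrt (sqrt \<dots>) = sqrt (sqrt (\<bar>dZ\<bar> ^ 3 * s ^ 5)) * s"
      using s by (simp only: real_sqrt_mult real_sqrt_abs) simp
    finally show ?thesis
      using s by (simp add: dry_rate_def field_simps power2_eq_square power3_eq_cube)
  qed
  finally show ?thesis using s by (simp add: s_def abs_mult power_abs)
qed

lemma Fr2_at_top:
  assumes g: "g > 0" and q: "q \<noteq> 0" and X: "(X \<longlongrightarrow> a) G" and Y: "(Y \<longlongrightarrow> b) G"
    and ab: "a * b = 0" "a + b \<noteq> 0" and pos: "\<forall>\<^sub>F t in G. X t > 0 \<and> Y t > 0"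
  shows "filterlim (\<lambda>t. Fr2 g (X t) (Y t) q) at_top G"
proof -
  let ?r = "\<lambda>t. 2 * g * (X t)\<^sup>2 * (Y t)\<^sup>2 / (q\<^sup>2 * (X t + Y t))"
  have "(?r \<longlongrightarrow> 2 * g * a\<^sup>2 * b\<^sup>2 / (q\<^sup>2 * (a + b))) G"
    using ab q by (intro tendsto_intros X Y) auto
  then have "(?r \<longlongrightarrow> 0) G" using ab by auto
  moreover have "\<forall>\<^sub>F t in G. ?r t > 0"
    using pos by eventually_elim (use g q in auto)
  ultimately have "filterlim (\<lambda>t. inverse (?r t)) at_top G" by (rule filterlim_inverse_at_top)
  then show ?thesis by (simp add: Fr2_def)
qed

text \<open>
  For \<open>q = 0\<close> the Froude number vanishes identically and the formula has no singularity at a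
  vanishing height. For \<open>q \<noteq> 0\<close> the Froude number tends to infinity while the height difference
  stays away from \<open>0\<close>, and the second estimate forces \<open>Hcal \<rightarrow> 0\<close>.
\<close>

lemma Hcal_convergent_one_dry:
  assumes g: "g > 0" and X: "(X \<longlongrightarrow> a) G" and Y: "(Y \<longlongrightarrow> b) G"
    and ab: "a * b = 0" "a + b \<noteq> 0" and pos: "\<forall>\<^sub>F t in G. X t > 0 \<and> Y t > 0"
  shows "\<exists>l. ((\<lambda>t. Hcal g (X t) (Y t) q dZ) \<longlongrightarrow> l) G"
proof (cases "q = 0")
  case True
  then have F: "Fr2 g x y q = 0" for x y by (simp add: Fr2_def)
  show ?thesis
  proof (cases "dZ = 0")
    case True
    then show ?thesis by (auto simp: Hcal_0 F)
  next
    case False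
    then have "((\<lambda>t. Hcal g (X t) (Y t) q dZ) \<longlongrightarrow> Hcal g a b q dZ) G"
      by (intro Hcal_tendsto_nonzero X Y tendsto_const) (simp_all add: F)
    then show ?thesis by blast
  qed
next
  case False
  let ?F = "\<lambda>t. Fr2 g (X t) (Y t) q"
  have top: "filterlim (\<lambda>t. - 1 + ?F t) at_top G"
    by (rule filterlim_tendsto_add_at_top[OF tendsto_const Fr2_at_top[OF g False X Y ab pos]])
  have sup: "\<forall>\<^sub>F t in G. 0 < - 1 + ?F t"
    using top unfolding filterlim_at_top_dense by blast
  have "((\<lambda>t. \<bar>dZ\<bar> / (- 1 + ?F t)) \<longlongrightarrow> 0) G"
    by (rule tendsto_divide_0[OF tendsto_const filterlim_at_top_imp_at_infinity[OF top]])
  moreover have "\<forall>\<^sub>F t in G. norm (Hcal g (X t) (Y t) q dZ) \<le> \<bar>dZ\<bar> / (- 1 + ?F t)"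
  proof (cases "dZ = 0")
    case True
    show ?thesis using sup by eventually_elim (simp add: True Hcal_0)
  next
    case False
    have "\<bar>b - a\<bar> > 0" using ab by auto
    have "filterlim (\<lambda>t. (- 1 + ?F t)\<^sup>2 * \<bar>Y t - X t\<bar>) at_top G"
      by (rule filterlim_at_top_mult_tendsto_pos[OF _ \<open>\<bar>b - a\<bar> > 0\<close>])
        (use X Y top in \<open>auto intro!: tendsto_intros filterlim_pow_at_top\<close>)
    then have "\<forall>\<^sub>F t in G. 64 * \<bar>dZ\<bar> \<le> (- 1 + ?F t)\<^sup>2 * \<bar>Y t - X t\<bar>"
      by (simp add: filterlim_at_top)
    with sup show ?thesis
    proof eventually_elim
      case (elim t)
      have "64 * \<bar>dZ\<bar> \<le> (1 - ?F t)\<^sup>2 * \<bar>Y t - X t\<bar>"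
        using elim(2) by (simp add: power2_eq_square algebra_simps)
      from abs_Hcal_formula_le_divide[OF False this] elim(1) False
      show ?case by (simp add: Hcal_nonzero)
    qed
  qed
  ultimately have "((\<lambda>t. Hcal g (X t) (Y t) q dZ) \<longlongrightarrow> 0) G"
    by (rule Lim_null_comparison[rotated])
  then show ?thesis by blast
qed

lemma convergent_wet_cubed_Hcal:
  assumes g: "g > 0" and ab: "a \<ge> 0" "b \<ge> 0"
  shows "\<exists>l. ((\<lambda>(x, y). 1 / (x + y) * (Hcal g x y q dZ) ^ 3) \<longlongrightarrow> l) (wet a \<times>\<^sub>F wet b)"
proof -
  let ?G = "wet a \<times>\<^sub>F wet b"
  let ?\<Phi> = "\<lambda>p. 1 / (fst p + snd p) * (Hcal g (fst p) (snd p) q dZ) ^ 3"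
  note lims = tendsto_fst_wet[OF ab] tendsto_snd_wet[OF ab]
  consider "a > 0" "b > 0" | "a = 0" "b = 0" | "a * b = 0" "a + b \<noteq> 0"
    using ab by force
  then show ?thesis
  proof cases
    case 1
    then show ?thesis by (rule convergent_wet_pos)
  next
    case 2
    have "(?\<Phi> \<longlongrightarrow> 0) ?G"
    proof (rule Lim_null_comparison)
      have "((\<lambda>p. dry_rate dZ (fst p + snd p)) \<longlongrightarrow> dry_rate dZ (a + b)) ?G"
        by (rule isCont_tendsto_compose[OF isCont_dry_rate]) (intro tendsto_intros lims)
      then show "((\<lambda>p. dry_rate dZ (fst p + snd p)) \<longlongrightarrow> 0) ?G"
        using 2 by (simp add: dry_rate_def)
      show "\<forall>\<^sub>F p in ?G. norm (?\<Phi> p) \<le> dry_rate dZ (fst p + snd p)"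
        using eventually_wet_pos[OF ab]
        by eventually_elim (simp only: real_norm_def, rule abs_cubed_Hcal_le, auto)
    qed
    then show ?thesis unfolding case_prod_beta by blast
  next
    case 3
    obtain l where "((\<lambda>p. Hcal g (fst p) (snd p) q dZ) \<longlongrightarrow> l) ?G"
      using Hcal_convergent_one_dry[OF g lims 3 eventually_wet_pos[OF ab]] by blast
    then have "(?\<Phi> \<longlongrightarrow> 1 / (a + b) * l ^ 3) ?G"
      using 3 by (intro tendsto_intros lims) auto
    then show ?thesis unfolding case_prod_beta by blast
  qed
qed

section \<open>The drying cell\<close>

text \<open>
  The intermediate height \<open>U\<close> at an interface is either the drying height itself, and then \<open>Hcal = 0\<close>
  for lack of a height difference, or a fixed positive height \<open>c\<close>. In that case
  \<open>Fr2 = (\<kappa> / \<eta>)\<^sup>2 * (\<eta> + c) / (2 * g * c\<^sup>2) \<rightarrow> 0\<close>, while \<open>Hcal\<close> is bounded by the first estimate.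
\<close>

lemma Fr2_mult_Hcal_tendsto_0:
  assumes g: "g > 0" and \<eta>: "filterlim \<eta> (at_right 0) G" and \<kappa>: "((\<lambda>t. \<kappa> t / \<eta> t) \<longlongrightarrow> 0) G"
    and U: "U = \<eta> \<or> (\<exists>c > 0. U = (\<lambda>_. c))"
  shows "((\<lambda>t. Fr2 g (\<eta> t) (U t) (\<kappa> t) * Hcal g (\<eta> t) (U t) (\<kappa> t) dZ) \<longlongrightarrow> 0) G"
  using U
proof (elim disjE exE conjE)
  assume "U = \<eta>"
  then show ?thesis by (simp add: Hcal_equal_heights)
next
  fix c :: real
  assume c: "c > 0" and U: "U = (\<lambda>_. c)"
  have \<eta>0: "(\<eta> \<longlongrightarrow> 0) G" using \<eta> by (simp add: filterlim_at)
  have "((\<lambda>t. (\<kappa> t / \<eta> t)\<^sup>2 * (\<eta> t + c) / (2 * g * c\<^sup>2)) \<longlongrightarrow> 0\<^sup>2 * (0 + c) / (2 * g * c\<^sup>2)) G"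
    using g c by (intro tendsto_intros \<kappa> \<eta>0) auto
  then have F: "((\<lambda>t. Fr2 g (\<eta> t) c (\<kappa> t)) \<longlongrightarrow> 0) G"
    by (simp add: Fr2_def power_divide mult_ac)
  let ?b = "\<lambda>x. \<bar>c - x\<bar> / 2 + sqrt (sqrt (\<bar>dZ\<bar> * \<bar>c - x\<bar> ^ 3)) / 4"
  have "((\<lambda>t. \<bar>Fr2 g (\<eta> t) c (\<kappa> t)\<bar> * ?b (\<eta> t)) \<longlongrightarrow> \<bar>0\<bar> * ?b 0) G"
    by (intro tendsto_intros F \<eta>0) auto
  then have "((\<lambda>t. \<bar>Fr2 g (\<eta> t) c (\<kappa> t)\<bar> * ?b (\<eta> t)) \<longlongrightarrow> 0) G" by simp
  then show ?thesis unfolding U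
  proof (rule Lim_null_comparison[rotated], intro always_eventually allI)
    fix t
    show "norm (Fr2 g (\<eta> t) c (\<kappa> t) * Hcal g (\<eta> t) c (\<kappa> t) dZ) \<le> \<bar>Fr2 g (\<eta> t) c (\<kappa> t)\<bar> * ?b (\<eta> t)"
      unfolding real_norm_def abs_mult by (intro mult_left_mono abs_Hcal_le) simp
  qed
qed

lemma reconstruction_tendsto_0:
  fixes c :: real
  assumes "c \<le> 0" "filterlim \<eta> (at_right 0) G" "(P \<longlongrightarrow> 0) G"
  shows "((\<lambda>t. max 0 (\<eta> t + c + 2 * P t)) \<longlongrightarrow> 0) G"
proof -
  have "((\<lambda>t. max 0 (\<eta> t + c + 2 * P t)) \<longlongrightarrow> max 0 (0 + c + 2 * 0)) G"
    using assms by (intro tendsto_intros) (auto simp: filterlim_at)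
  then show ?thesis using assms by simp
qed

text \<open>
  The bottom of the intermediate state is never below that of the drying cell, so the topography
  term of a reconstructed height is nonpositive. Everything else in that height tends to \<open>0\<close>.
\<close>

lemma dry_cell_limits:
  fixes h q Z :: "int \<Rightarrow> real"
  assumes g: "g > 0"
    and wetL: "Z (i - 1) > Z i \<Longrightarrow> h (i - 1) > 0" and wetR: "Z i \<le> Z (i + 1) \<Longrightarrow> h (i + 1) > 0"
    and \<eta>: "filterlim \<eta> (at_right 0) F" and \<kappa>: "((\<lambda>t. \<kappa> t / \<eta> t) \<longlongrightarrow> 0) F"
  defines "hh \<equiv> \<lambda>t. h(i := \<eta> t)" and "qq \<equiv> \<lambda>t. q(i := \<kappa> t)"
  shows "((\<lambda>t. Fr2 g (hh t i) (upper Z (hh t) i) (qq t i) *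
           Hcal g (hh t i) (upper Z (hh t) i) (qq t i) (upper Z Z i - Z i)) \<longlongrightarrow> 0) F" (is ?A)
    and "((\<lambda>t. Fr2 g (hh t i) (upper Z (hh t) (i - 1)) (qq t i) *
           Hcal g (hh t i) (upper Z (hh t) (i - 1)) (qq t i) (upper Z Z (i - 1) - Z i)) \<longlongrightarrow> 0) F" (is ?B)
    and "((\<lambda>t. h_minus g (hh t) (qq t) Z i) \<longlongrightarrow> 0) F" (is ?C)
    and "((\<lambda>t. h_plus g (hh t) (qq t) Z i) \<longlongrightarrow> 0) F" (is ?D)
proof -
  have own: "hh t i = \<eta> t" "qq t i = \<kappa> t" for t by (simp_all add: hh_def qq_def)
  have "(\<lambda>t. upper Z (hh t) i) = \<eta> \<or> (\<exists>c > 0. (\<lambda>t. upper Z (hh t) i) = (\<lambda>_. c))"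
    using wetR by (cases "Z i > Z (i + 1)") (auto simp: upper_def hh_def)
  from Fr2_mult_Hcal_tendsto_0[OF g \<eta> \<kappa> this] show A: ?A unfolding own .
  have "(\<lambda>t. upper Z (hh t) (i - 1)) = \<eta> \<or> (\<exists>c > 0. (\<lambda>t. upper Z (hh t) (i - 1)) = (\<lambda>_. c))"
    using wetL by (cases "Z (i - 1) > Z i") (auto simp: upper_def hh_def)
  from Fr2_mult_Hcal_tendsto_0[OF g \<eta> \<kappa> this] show B: ?B unfolding own .
  have "Z i - upper Z Z i \<le> 0" "Z i - upper Z Z (i - 1) \<le> 0" by (auto simp: upper_def)
  from reconstruction_tendsto_0[OF this(1) \<eta> A] reconstruction_tendsto_0[OF this(2) \<eta> B]
  show ?C ?D unfolding h_minus_def h_plus_def own by (simp_all add: mult.assoc)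
qed

section \<open>The three properties of the height correction\<close>

theorem proposition5:
  fixes g :: real
  assumes g: "g > 0"
  shows
    \<comment> \<open>the limits used as definitions at \<open>\<Delta>Z = 0\<close> and at vanishing heights exist\<close>
    "((\<forall>hL > 0. \<forall>hR > 0. \<forall>q. \<exists>l. (Hcal_formula g hL hR q \<longlongrightarrow> l) (at 0)) \<and>
      (\<forall>a \<ge> 0. \<forall>b \<ge> 0. \<forall>q dZ. \<exists>l.
         ((\<lambda>(x, y). 1 / (x + y) * (Hcal g x y q dZ) ^ 3) \<longlongrightarrow> l) (wet a \<times>\<^sub>F wet b)) \<and>
      (\<forall>a \<ge> 0. \<forall>b \<ge> 0. \<exists>l. ((\<lambda>(x, y). x * y / (x + y)) \<longlongrightarrow> l) (wet a \<times>\<^sub>F wet b)))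
     \<and>
     ((\<forall>hL > 0. \<forall>hR > 0. \<forall>q dZ. \<not> (dZ = 0 \<and> 1 - Fr2 g hL hR q = 0) \<longrightarrow>
         isCont (\<lambda>z. Hcal g hL hR q z) dZ \<and>
         (Fr2 g hL hR q \<noteq> 1 \<or> hL = hR \<longrightarrow>
            isCont (\<lambda>(x, y, p, z). Hcal g x y p z) (hL, hR, q, dZ))) \<and>
      (\<forall>hL > 0. \<forall>hR > 0. \<forall>q. 1 - Fr2 g hL hR q \<noteq> 0 \<longrightarrow>
         ((\<lambda>z. Hcal g hL hR q z) \<longlongrightarrow> 0) (at 0)))
     \<and>
     ((\<forall>hL > 0. \<forall>hR > 0. \<forall>q dZ.
         dZ = - (hR - hL) * (1 - Fr2 g hL hR q) \<and> Fr2 g hL hR q \<noteq> 1 \<longrightarrow>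
         Hcal g hL hR q dZ = 1 / 2 * (hR - hL)) \<and>
      \<comment> \<open>\<open>h\<^sub>R - h\<^sub>L = O(\<Delta>Z)\<close>, uniformly as long as \<open>Fr\<^sup>2\<close> stays away from 1\<close>
      (\<forall>c > 0. \<exists>C. \<forall>hL > 0. \<forall>hR > 0. \<forall>q dZ.
         dZ = - (hR - hL) * (1 - Fr2 g hL hR q) \<and> \<bar>1 - Fr2 g hL hR q\<bar> \<ge> c \<longrightarrow>
         \<bar>hR - hL\<bar> \<le> C * \<bar>dZ\<bar>))
     \<and>
     \<comment> \<open>the height \<open>\<eta>\<close> and discharge \<open>\<kappa>\<close> of cell \<open>i\<close> vary along an arbitrary filter,
         subject to the dry-area convention; the other cells and the topography are fixed\<close>
     (\<forall>(h :: int \<Rightarrow> real) (q :: int \<Rightarrow> real) (Z :: int \<Rightarrow> real) (i :: int)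
        (F :: 'a filter) (\<eta> :: 'a \<Rightarrow> real) (\<kappa> :: 'a \<Rightarrow> real).
        (Z (i - 1) > Z i \<longrightarrow> h (i - 1) > 0) \<and> (Z i \<le> Z (i + 1) \<longrightarrow> h (i + 1) > 0) \<and>
        filterlim \<eta> (at_right 0) F \<and>
        ((\<lambda>t. \<kappa> t / \<eta> t) \<longlongrightarrow> 0) F \<and> Bfun (\<lambda>t. (\<kappa> t)\<^sup>2 / (\<eta> t) ^ 3) F \<longrightarrow>
        (let hh = (\<lambda>t. h(i := \<eta> t)); qq = (\<lambda>t. q(i := \<kappa> t));
             hm = (\<lambda>t. h_plus g (hh t) (qq t) Z i);
             hp = (\<lambda>t. h_minus g (hh t) (qq t) Z i)
         in
           ((\<lambda>t. Fr2 g (hh t i) (upper Z (hh t) i) (qq t i) *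
                 Hcal g (hh t i) (upper Z (hh t) i) (qq t i) (upper Z Z i - Z i)) \<longlongrightarrow> 0) F \<and>
           ((\<lambda>t. Fr2 g (hh t i) (upper Z (hh t) (i - 1)) (qq t i) *
                 Hcal g (hh t i) (upper Z (hh t) (i - 1)) (qq t i) (upper Z Z (i - 1) - Z i))
              \<longlongrightarrow> 0) F \<and>
           ((\<lambda>t. wet_ext (\<lambda>x y. 1 / (x + y) *
                     (Hcal g x y (qq t i) (upper Z Z i - upper Z Z (i - 1))) ^ 3) (hm t) (hp t))
              \<longlongrightarrow> 0) F \<and>
           ((\<lambda>t. wet_ext (\<lambda>x y. x * y / (x + y)) (hm t) (hp t)) \<longlongrightarrow> 0) F))"
proof (intro conjI allI impI)
  fix hL hR q :: real
  show "\<exists>l. (Hcal_formula g hL hR q \<longlongrightarrow> l) (at 0)"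
    using Hcal_formula_tendsto_at_0 by blast
next
  fix a b q dZ :: real
  assume "a \<ge> 0" "b \<ge> 0"
  with g show "\<exists>l. ((\<lambda>(x, y). 1 / (x + y) * (Hcal g x y q dZ) ^ 3) \<longlongrightarrow> l) (wet a \<times>\<^sub>F wet b)"
    by (rule convergent_wet_cubed_Hcal)
next
  fix a b :: real
  assume "a \<ge> 0" "b \<ge> 0"
  then show "\<exists>l. ((\<lambda>(x, y). x * y / (x + y)) \<longlongrightarrow> l) (wet a \<times>\<^sub>F wet b)"
    by (rule convergent_wet_half_harmonic_mean)
next
  fix hL hR q dZ :: real
  assume "\<not> (dZ = 0 \<and> 1 - Fr2 g hL hR q = 0)"
  then show "isCont (\<lambda>z. Hcal g hL hR q z) dZ"
    by (intro isCont_Hcal_dZ) auto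
next
  fix hL hR q dZ :: real
  assume "hL > 0" "hR > 0" "\<not> (dZ = 0 \<and> 1 - Fr2 g hL hR q = 0)" "Fr2 g hL hR q \<noteq> 1 \<or> hL = hR"
  then show "isCont (\<lambda>(x, y, p, z). Hcal g x y p z) (hL, hR, q, dZ)"
    unfolding isCont_def case_prod_beta
    by (intro Hcal_tendsto[OF g, THEN tendsto_eq_rhs] tendsto_eq_intros) auto
next
  fix hL hR q :: real
  assume "1 - Fr2 g hL hR q \<noteq> 0"
  then show "((\<lambda>z. Hcal g hL hR q z) \<longlongrightarrow> 0) (at 0)"
    using isCont_Hcal_dZ[of 0 g hL hR q] by (simp add: isCont_def Hcal_0)
next
  fix hL hR q dZ :: real
  assume "dZ = - (hR - hL) * (1 - Fr2 g hL hR q) \<and> Fr2 g hL hR q \<noteq> 1"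
  then show "Hcal g hL hR q dZ = 1 / 2 * (hR - hL)"
    using Hcal_equilibrium by simp
next
  fix c :: real
  assume c: "c > 0"
  show "\<exists>C. \<forall>hL > 0. \<forall>hR > 0. \<forall>q dZ.
      dZ = - (hR - hL) * (1 - Fr2 g hL hR q) \<and> \<bar>1 - Fr2 g hL hR q\<bar> \<ge> c \<longrightarrow>
      \<bar>hR - hL\<bar> \<le> C * \<bar>dZ\<bar>"
  proof (intro exI[of _ "1 / c"] allI impI, elim conjE)
    fix hL hR q dZ :: real
    assume "dZ = - (hR - hL) * (1 - Fr2 g hL hR q)" and f: "c \<le> \<bar>1 - Fr2 g hL hR q\<bar>"
    then have "\<bar>dZ\<bar> = \<bar>hR - hL\<bar> * \<bar>1 - Fr2 g hL hR q\<bar>"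
      by (simp add: abs_mult abs_minus_commute)
    moreover have "\<bar>hR - hL\<bar> * c \<le> \<dots>" using f by (intro mult_left_mono) auto
    ultimately show "\<bar>hR - hL\<bar> \<le> 1 / c * \<bar>dZ\<bar>" using c by (simp add: field_simps)
  qed
next
  fix h q Z :: "int \<Rightarrow> real" and i :: int and F :: "'a filter" and \<eta> \<kappa> :: "'a \<Rightarrow> real"
  assume "(Z (i - 1) > Z i \<longrightarrow> h (i - 1) > 0) \<and> (Z i \<le> Z (i + 1) \<longrightarrow> h (i + 1) > 0) \<and>
    filterlim \<eta> (at_right 0) F \<and>
    ((\<lambda>t. \<kappa> t / \<eta> t) \<longlongrightarrow> 0) F \<and> Bfun (\<lambda>t. (\<kappa> t)\<^sup>2 / (\<eta> t) ^ 3) F"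
  then have dry: "Z (i - 1) > Z i \<Longrightarrow> h (i - 1) > 0" "Z i \<le> Z (i + 1) \<Longrightarrow> h (i + 1) > 0"
    "filterlim \<eta> (at_right 0) F" "((\<lambda>t. \<kappa> t / \<eta> t) \<longlongrightarrow> 0) F"
    by blast+
  note lims = dry_cell_limits[where q = q, OF g dry]
  have nonneg: "h_plus g h' q' Z i \<ge> 0" "h_minus g h' q' Z i \<ge> 0" for h' q'
    by (simp_all add: h_plus_def h_minus_def)
  have mean: "\<bar>x * y / (x + y)\<bar> \<le> x + y" if "x > 0" "y > 0" for x y :: real
    using that by (simp add: field_simps)
  show "let hh = (\<lambda>t. h(i := \<eta> t)); qq = (\<lambda>t. q(i := \<kappa> t));
          hm = (\<lambda>t. h_plus g (hh t) (qq t) Z i);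
          hp = (\<lambda>t. h_minus g (hh t) (qq t) Z i)
      in
        ((\<lambda>t. Fr2 g (hh t i) (upper Z (hh t) i) (qq t i) *
              Hcal g (hh t i) (upper Z (hh t) i) (qq t i) (upper Z Z i - Z i)) \<longlongrightarrow> 0) F \<and>
        ((\<lambda>t. Fr2 g (hh t i) (upper Z (hh t) (i - 1)) (qq t i) *
              Hcal g (hh t i) (upper Z (hh t) (i - 1)) (qq t i) (upper Z Z (i - 1) - Z i))
           \<longlongrightarrow> 0) F \<and>
        ((\<lambda>t. wet_ext (\<lambda>x y. 1 / (x + y) *
                  (Hcal g x y (qq t i) (upper Z Z i - upper Z Z (i - 1))) ^ 3) (hm t) (hp t))
           \<longlongrightarrow> 0) F \<and>
        ((\<lambda>t. wet_ext (\<lambda>x y. x * y / (x + y)) (hm t) (hp t)) \<longlongrightarrow> 0) F"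
    unfolding Let_def
  proof (intro conjI)
    show "((\<lambda>t. wet_ext (\<lambda>x y. 1 / (x + y) *
        (Hcal g x y ((q(i := \<kappa> t)) i) (upper Z Z i - upper Z Z (i - 1))) ^ 3)
        (h_plus g (h(i := \<eta> t)) (q(i := \<kappa> t)) Z i) (h_minus g (h(i := \<eta> t)) (q(i := \<kappa> t)) Z i))
        \<longlongrightarrow> 0) F"
      by (rule wet_ext_tendsto_0[where B = "dry_rate (upper Z Z i - upper Z Z (i - 1))"])
        (use lims nonneg g convergent_wet_cubed_Hcal abs_cubed_Hcal_le isCont_dry_rate
          in \<open>auto simp: dry_rate_def[of _ 0]\<close>)
    show "((\<lambda>t. wet_ext (\<lambda>x y. x * y / (x + y))
        (h_plus g (h(i := \<eta> t)) (q(i := \<kappa> t)) Z i) (h_minus g (h(i := \<eta> t)) (q(i := \<kappa> t)) Z i))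
        \<longlongrightarrow> 0) F"
      by (rule wet_ext_tendsto_0[where B = "\<lambda>s. s"])
        (use lims nonneg convergent_wet_half_harmonic_mean mean in auto)
  qed (use lims in auto)
qed

end
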